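(* Let $(X,d)$ be a compact metric space, let $R_1,\dots,R_N$ be contractive iterated function systems on $X$, let $Z\in K^*(X)$ and $\theta=(\theta_1,\theta_2,\dots)\in\Omega=\{1,\dots,N\}^{\mathbb N}$, and let $\mathcal A(\theta)$ be the blend of the attractors $A_{R_i}$, $i=1,\dots,N$, by $\theta$. Let $(\hat X,r)$ be a finite discretization of $X$ with resolution $\varepsilon>0$, let $k\ge 1$ be an integer, and define finite subsets of $\hat X$ by $$Y_{k+1}=\widehat Z,\qquad Y_j=\widehat{F_{R_{\theta_j}}(\widehat{Y_{j+1}})},\quad 1\le j\le k .$$ Then: (1) $d_H\big(F_{R_{\theta_1}}(\cdots(F_{R_{\theta_k}}(Z))),\,Y_1\big)\le \frac{\varepsilon}{1-\lambda_{\mathcal R}}$; (2) $d_H(\mathcal A(\theta),Y_1)\le \lambda_{\mathcal R}^k\operatorname{diam}(X)+\frac{\varepsilon}{1-\lambda_{\mathcal R}}$.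
   Context: $K^*(X)$ is the set of non-empty compact subsets of $X$, with the Hausdorff--Pompeiu distance $d_H(A,B)=\max(d(A,B),d(B,A))$, where $d(A,B)=\sup_{a\in A}\inf_{b\in B}d(a,b)$. A contractive iterated function system (IFS) $R=(X,f_j,\,j=1,\dots,n)$ is a finite family of maps $f_j:X\to X$ together with numbers $\lambda_j\in[0,1)$ such that $\operatorname{Lip}(f_j)<\lambda_j$ for all $j$; its contractivity constant is $\lambda_R:=\max_j\lambda_j$. Its Hutchinson--Barnsley operator is $F_R(B)=\bigcup_{j=1}^n f_j(B)$; it maps $K^*(X)$ to itself, and its attractor $A_R$ is the unique element of $K^*(X)$ with $F_R(A_R)=A_R$. Given contractive IFSs $R_i=(X,f^i_j,\,j=1,\dots,n_i)$, $i=1,\dots,N$, their blending is the IFS $\mathcal R=(K^*(X),F_{R_i},\,i=1,\dots,N)$ on $(K^*(X),d_H)$, with contractivity constant $\lambda_{\mathcal R}=\max_i\lambda_{R_i}<1$. For $\theta\in\Omega:=\{1,\dots,N\}^{\mathbb N}$, the blend of the attractors $A_{R_i}$ by $\theta$ is $$\mathcal A(\theta):=\lim_{k\to\infty}F_{R_{\theta_1}}(F_{R_{\theta_2}}(\cdots F_{R_{\theta_k}}(Z)))\in K^*(X),$$ the limit being in $d_H$; it exists and does not depend on $Z\in K^*(X)$. A set $\hat X\subset X$ is an $\varepsilon$-net if for every $x\in X$ there is $y\in\hat X$ with $d(x,y)\le\varepsilon$; $\varepsilon$ is called the resolution. A map $r:X\to\hat X$ is an $\varepsilon$-projection if $r|_{\hat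 X}=\mathrm{id}$ and $d(x,r(x))\le\varepsilon$ for all $x\in X$. The pair $(\hat X,r)$ is a discretization of $X$ (with resolution $\varepsilon$) if $\hat X$ is an $\varepsilon$-net and $r:X\to\hat X$ is an $\varepsilon$-projection; it is finite if $\hat X$ is finite. For $B\subset X$, $\widehat B:=r(B)\subset\hat X$. *)

theory Defs
  imports "HOL-Analysis.Analysis"
begin

text \<open>
  The ambient space is a set \<open>X\<close> in a metric type; \<open>X = UNIV\<close> gives the whole type.
  All indices (of maps, of systems, of the entries of a code sequence) start at 1.
\<close>

definition hyperspace :: "'a::metric_space set \<Rightarrow> 'a set set" where
  "hyperspace X = {B. B \<subseteq> X \<and> B \<noteq> {} \<and> compact B}"

text \<open>
  For \<open>B \<noteq> {}\<close>, \<open>infdist a B\<close> is the infimum of \<open>dist a b\<close> over \<open>b \<in> B\<close>. The real-valued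
  supremum is meaningful for nonempty bounded sets only.
\<close>

definition hausdorff_excess :: "'a::metric_space set \<Rightarrow> 'a set \<Rightarrow> real" where
  "hausdorff_excess A B = (SUP a\<in>A. infdist a B)"

definition hausdorff_dist :: "'a::metric_space set \<Rightarrow> 'a set \<Rightarrow> real" where
  "hausdorff_dist A B = max (hausdorff_excess A B) (hausdorff_excess B A)"

text \<open>The least Lipschitz constant; it is \<open>\<infinity>\<close> for a map that is not Lipschitz.\<close>

definition Lip :: "'a::metric_space set \<Rightarrow> ('a \<Rightarrow> 'a) \<Rightarrow> ennreal" where
  "Lip X f = Inf {ennreal L | L. L-lipschitz_on X f}"

text \<open>
  The numbers \<open>\<lambda>\<^sub>j\<close> are data of the system, not derived from the maps. The type does not require
  a metric on \<open>'a\<close>, so that it also accommodates systems acting on \<open>hyperspace X\<close>.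
\<close>

record 'a ifs =
  num_maps :: nat
  ifs_map :: "nat \<Rightarrow> 'a \<Rightarrow> 'a"
  ratio :: "nat \<Rightarrow> real"

definition contractive_ifs :: "'a::metric_space set \<Rightarrow> 'a ifs \<Rightarrow> bool" where
  "contractive_ifs X R \<longleftrightarrow> 1 \<le> num_maps R \<and>
     (\<forall>j\<in>{1..num_maps R}. ifs_map R j \<in> X \<rightarrow> X \<and> 0 \<le> ratio R j \<and> ratio R j < 1 \<and>
        Lip X (ifs_map R j) < ennreal (ratio R j))"

definition contractivity :: "'a ifs \<Rightarrow> real" where
  "contractivity R = Max (ratio R ` {1..num_maps R})"

definition hutchinson :: "'a ifs \<Rightarrow> 'a set \<Rightarrow> 'a set" where
  "hutchinson R B = (\<Union>j\<in>{1..num_maps R}. ifs_map R j ` B)"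

definition blending :: "nat \<Rightarrow> (nat \<Rightarrow> 'a ifs) \<Rightarrow> 'a set ifs" where
  "blending N R = \<lparr>num_maps = N, ifs_map = (\<lambda>i. hutchinson (R i)),
                   ratio = (\<lambda>i. contractivity (R i))\<rparr>"

text \<open>\<open>code_iterate R \<theta> k Z\<close> is \<open>F\<^sub>\<theta>\<^sub>1 (F\<^sub>\<theta>\<^sub>2 (\<dots> (F\<^sub>\<theta>\<^sub>k Z)))\<close> with \<open>F\<^sub>i = hutchinson (R i)\<close>.\<close>

definition code_iterate :: "(nat \<Rightarrow> 'a ifs) \<Rightarrow> (nat \<Rightarrow> nat) \<Rightarrow> nat \<Rightarrow> 'a set \<Rightarrow> 'a set" where
  "code_iterate R \<theta> k Z = foldr (\<lambda>j. hutchinson (R (\<theta> j))) [1..<k + 1] Z"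

text \<open>
  The limit, with respect to \<open>hausdorff_dist\<close> on \<open>hyperspace X\<close>, common to all initial sets \<open>Z\<close>.
\<close>

definition blend :: "'a::metric_space set \<Rightarrow> (nat \<Rightarrow> 'a ifs) \<Rightarrow> (nat \<Rightarrow> nat) \<Rightarrow> 'a set" where
  "blend X R \<theta> = (THE A. A \<in> hyperspace X \<and>
     (\<forall>Z\<in>hyperspace X. (\<lambda>k. hausdorff_dist (code_iterate R \<theta> k Z) A) \<longlonglongrightarrow> 0))"

definition eps_net :: "real \<Rightarrow> 'a::metric_space set \<Rightarrow> 'a set \<Rightarrow> bool" where
  "eps_net \<epsilon> X Xh \<longleftrightarrow> Xh \<subseteq> X \<and> (\<forall>x\<in>X. \<exists>y\<in>Xh. dist x y \<le> \<epsilon>)"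

definition eps_projection :: "real \<Rightarrow> 'a::metric_space set \<Rightarrow> 'a set \<Rightarrow> ('a \<Rightarrow> 'a) \<Rightarrow> bool" where
  "eps_projection \<epsilon> X Xh r \<longleftrightarrow>
     r \<in> X \<rightarrow> Xh \<and> (\<forall>y\<in>Xh. r y = y) \<and> (\<forall>x\<in>X. dist x (r x) \<le> \<epsilon>)"

definition discretization :: "real \<Rightarrow> 'a::metric_space set \<Rightarrow> 'a set \<Rightarrow> ('a \<Rightarrow> 'a) \<Rightarrow> bool" where
  "discretization \<epsilon> X Xh r \<longleftrightarrow> eps_net \<epsilon> X Xh \<and> eps_projection \<epsilon> X Xh r"

end

theory Submission
  imports Defs
begin

text \<open>
  Write \<open>F\<^sub>j\<close> for the Hutchinson operator of the \<open>j\<close>-th system of the code and \<open>q\<close> for the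
  contractivity constant of the blending. Each \<open>F\<^sub>j\<close> contracts the Hausdorff distance by the
  factor \<open>q\<close>, so the composition \<open>F\<^sub>1 \<circ> \<dots> \<circ> F\<^sub>k\<close> contracts it by \<open>q\<^sup>k\<close>
  (\<open>hausdorff_close_code_iterate\<close>).

  The first bound is a telescoping argument. Projecting a set onto the net moves it by at most
  \<open>\<epsilon>\<close>. Hence replacing \<open>Y\<^sub>j\<^sub>+\<^sub>1\<close> by the exact image \<open>F\<^sub>j\<^sub>+\<^sub>1(Y\<^sub>j\<^sub>+\<^sub>2)\<close> inside \<open>F\<^sub>1 \<circ> \<dots> \<circ> F\<^sub>j\<close> costs at most
  \<open>\<epsilon> q\<^sup>j\<close>; all the replacements from \<open>Y\<^sub>1\<close> to the exact iterate on \<open>Z\<close> together cost at most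
  \<open>\<epsilon> (1 + q + \<dots> + q\<^sup>k) \<le> \<epsilon> / (1 - q)\<close> (\<open>discretized_iterate_close\<close>).

  For the second bound the blend must be shown to exist. As \<open>X\<close> is compact, completeness of the
  hyperspace can be bypassed: the sets \<open>F\<^sub>1(\<dots>F\<^sub>k(X))\<close> are nonempty, compact and decreasing in
  \<open>k\<close>, and their intersection is the limit. It is within
  \<open>q\<^sup>k diam X\<close> of \<open>F\<^sub>1(\<dots>F\<^sub>k(Z))\<close> for every \<open>Z\<close> (\<open>code_iterate_close_limit_set\<close>),
  because \<open>F\<^sub>1 \<circ> \<dots> \<circ> F\<^sub>k\<close> shrinks the distance of any two nonempty subsets of \<open>X\<close> to that size.
  The triangle inequality combines this with the first bound.
\<close>

section \<open>Hausdorff distance through closeness of points\<close>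

text \<open>
  A pointwise description of \<open>hausdorff_dist A B \<le> e\<close>, valid for nonempty compact sets by
  \<open>hausdorff_dist_le_iff\<close>. Images, triangle inequality and nested intersections are easier to treat
  in this form than with suprema of infima.
\<close>
definition hausdorff_close :: "real \<Rightarrow> 'a::metric_space set \<Rightarrow> 'a set \<Rightarrow> bool" where
  "hausdorff_close e A B \<longleftrightarrow>
     (\<forall>a\<in>A. \<exists>b\<in>B. dist a b \<le> e) \<and> (\<forall>b\<in>B. \<exists>a\<in>A. dist a b \<le> e)"

lemma hausdorff_close_sym: "hausdorff_close e A B \<Longrightarrow> hausdorff_close e B A"
  unfolding hausdorff_close_def by (simp add: dist_commute)

lemma hausdorff_close_mono: "hausdorff_close e A B \<Longrightarrow> e \<le> e' \<Longrightarrow> hausdorff_close e' A B"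
  unfolding hausdorff_close_def by (meson order_trans)

lemma hausdorff_close_trans:
  assumes "hausdorff_close e A B" "hausdorff_close e' B C"
  shows "hausdorff_close (e + e') A C"
  unfolding hausdorff_close_def
proof (intro conjI ballI)
  fix a assume "a \<in> A"
  then obtain b c where "b \<in> B" "c \<in> C" "dist a b \<le> e" "dist b c \<le> e'"
    using assms unfolding hausdorff_close_def by meson
  then show "\<exists>c\<in>C. dist a c \<le> e + e'"
    by (metis add_mono dist_triangle order_trans)
next
  fix c assume "c \<in> C"
  then obtain b a where "b \<in> B" "a \<in> A" "dist a b \<le> e" "dist b c \<le> e'"
    using assms unfolding hausdorff_close_def by meson
  then show "\<exists>a\<in>A. dist a c \<le> e + e'"
    by (metis add_mono dist_triangle order_trans)
qed

lemma hausdorff_close_image: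
  assumes "\<And>x. x \<in> A \<Longrightarrow> dist x (f x) \<le> e"
  shows "hausdorff_close e A (f ` A)"
  unfolding hausdorff_close_def using assms by blast

lemma hausdorff_close_diameter:
  assumes "bounded X" "A \<subseteq> X" "B \<subseteq> X" "A \<noteq> {}" "B \<noteq> {}"
  shows "hausdorff_close (diameter X) A B"
  unfolding hausdorff_close_def using assms diameter_bounded_bound by blast

text \<open>
  Compactness of \<open>B\<close> makes the infimum of the distances to \<open>B\<close> attained, so that no slack has
  to be added to \<open>e\<close>; compactness of \<open>A\<close> makes the supremum a genuine one.
\<close>
lemma hausdorff_excess_le_iff:
  assumes "compact A" "A \<noteq> {}" "compact B" "B \<noteq> {}"
  shows "hausdorff_excess A B \<le> e \<longleftrightarrow> (\<forall>a\<in>A. \<exists>b\<in>B. dist a b \<le> e)"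
proof -
  have bdd: "bdd_above ((\<lambda>a. infdist a B) ` A)"
  proof (rule compact_imp_bounded[THEN bounded_imp_bdd_above])
    show "compact ((\<lambda>a. infdist a B) ` A)"
      by (intro compact_continuous_image continuous_intros assms)
  qed
  have "infdist a B \<le> e \<longleftrightarrow> (\<exists>b\<in>B. dist a b \<le> e)" for a
  proof
    assume "infdist a B \<le> e"
    moreover obtain b where b: "b \<in> B" "\<forall>c\<in>B. dist a b \<le> dist a c"
      using continuous_attains_inf[OF assms(3,4) continuous_on_dist[OF continuous_on_const continuous_on_id]]
      by blast
    moreover have "dist a b \<le> infdist a B"
      using b assms(4) unfolding infdist_notempty[OF assms(4)] by (intro cINF_greatest) auto
    ultimately show "\<exists>b\<in>B. dist a b \<le> e" by force
  next
    assume "\<exists>b\<in>B. dist a b \<le> e"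
    then show "infdist a B \<le> e" by (meson infdist_le2)
  qed
  then show ?thesis
    unfolding hausdorff_excess_def using cSUP_le_iff[OF assms(2) bdd] by simp
qed

lemma hausdorff_dist_le_iff:
  assumes "A \<in> hyperspace X" "B \<in> hyperspace X"
  shows "hausdorff_dist A B \<le> e \<longleftrightarrow> hausdorff_close e A B"
  using assms unfolding hausdorff_dist_def hausdorff_close_def hyperspace_def
  by (simp add: hausdorff_excess_le_iff dist_commute)

lemma hausdorff_close_0_imp_eq: "hausdorff_close 0 A B \<Longrightarrow> A = B"
  unfolding hausdorff_close_def by auto

text \<open>This makes the definite description in \<open>blend\<close> single-valued.\<close>
lemma hausdorff_limit_unique:
  assumes "A \<in> hyperspace X" "B \<in> hyperspace X" "\<And>k::nat. S k \<in> hyperspace X"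
    and A: "(\<lambda>k. hausdorff_dist (S k) A) \<longlonglongrightarrow> 0"
    and B: "(\<lambda>k. hausdorff_dist (S k) B) \<longlonglongrightarrow> 0"
  shows "A = B"
proof (rule hausdorff_close_0_imp_eq)
  have "hausdorff_dist A B \<le> 0"
  proof (rule LIMSEQ_le_const)
    show "(\<lambda>k. hausdorff_dist (S k) A + hausdorff_dist (S k) B) \<longlonglongrightarrow> 0"
      using tendsto_add[OF A B] by simp
    have "hausdorff_dist A B \<le> hausdorff_dist (S k) A + hausdorff_dist (S k) B" for k
      using hausdorff_close_trans[OF hausdorff_close_sym]
        hausdorff_dist_le_iff[OF assms(3) assms(1)] hausdorff_dist_le_iff[OF assms(3) assms(2)]
        hausdorff_dist_le_iff[OF assms(1,2)] by blast
    then show "\<exists>n. \<forall>k\<ge>n. hausdorff_dist A B \<le> hausdorff_dist (S k) A + hausdorff_dist (S k) B"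
      by blast
  qed
  then show "hausdorff_close 0 A B"
    using hausdorff_dist_le_iff[OF assms(1,2)] by blast
qed

section \<open>The Hutchinson operator as a contraction\<close>

lemma contractive_ifs_dist_le:
  assumes R: "contractive_ifs X R" and j: "j \<in> {1..num_maps R}" and xy: "x \<in> X" "y \<in> X"
  shows "dist (ifs_map R j x) (ifs_map R j y) \<le> contractivity R * dist x y"
proof -
  have "Lip X (ifs_map R j) < ennreal (ratio R j)"
    using R j unfolding contractive_ifs_def by blast
  then obtain L where L: "L-lipschitz_on X (ifs_map R j)" "ennreal L < ennreal (ratio R j)"
    unfolding Lip_def Inf_less_iff by blast
  have "L \<le> ratio R j"
    using L(2) lipschitz_on_nonneg[OF L(1)] by (simp add: ennreal_less_iff)
  also have "\<dots> \<le> contractivity R"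
    unfolding contractivity_def using j by (intro Max_ge) auto
  finally show ?thesis
    using lipschitz_onD[OF L(1) xy] by (meson mult_right_mono order_trans zero_le_dist)
qed

lemma contractivity_bounds:
  assumes "contractive_ifs X R"
  shows "0 \<le> contractivity R" "contractivity R < 1"
proof -
  have "ratio R ` {1..num_maps R} \<noteq> {}"
    using assms unfolding contractive_ifs_def by auto
  then have "contractivity R \<in> ratio R ` {1..num_maps R}"
    unfolding contractivity_def by (intro Max_in) auto
  then show "0 \<le> contractivity R" "contractivity R < 1"
    using assms unfolding contractive_ifs_def by auto
qed

lemma hutchinson_mono: "A \<subseteq> B \<Longrightarrow> hutchinson R A \<subseteq> hutchinson R B"
  unfolding hutchinson_def by blast

lemma hutchinson_hyperspace:
  assumes R: "contractive_ifs X R" and B: "B \<in> hyperspace X"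
  shows "hutchinson R B \<in> hyperspace X"
proof -
  have sub: "B \<subseteq> X" using B unfolding hyperspace_def by simp
  have "compact (ifs_map R j ` B)" if j: "j \<in> {1..num_maps R}" for j
  proof (rule compact_continuous_image)
    have "(contractivity R)-lipschitz_on B (ifs_map R j)"
      using contractive_ifs_dist_le[OF R j] contractivity_bounds[OF R] sub
      by (intro lipschitz_onI) auto
    then show "continuous_on B (ifs_map R j)" by (rule lipschitz_on_continuous_on)
    show "compact B" using B unfolding hyperspace_def by simp
  qed
  then have "compact (hutchinson R B)" unfolding hutchinson_def by (intro compact_UN) auto
  then show ?thesis
    using R B unfolding hutchinson_def hyperspace_def contractive_ifs_def by fastforce
qed

lemma hutchinson_close:
  assumes R: "contractive_ifs X R" and q: "contractivity R \<le> q"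
    and sub: "A \<subseteq> X" "B \<subseteq> X" and close: "hausdorff_close e A B"
  shows "hausdorff_close (q * e) (hutchinson R A) (hutchinson R B)"
proof -
  have le: "dist (ifs_map R j a) (ifs_map R j b) \<le> q * e"
    if "j \<in> {1..num_maps R}" "a \<in> A" "b \<in> B" "dist a b \<le> e" for j a b
  proof -
    have "dist (ifs_map R j a) (ifs_map R j b) \<le> contractivity R * dist a b"
      using contractive_ifs_dist_le[OF R] that sub by blast
    also have "\<dots> \<le> q * e"
      using q that(4) contractivity_bounds[OF R] by (intro mult_mono) auto
    finally show ?thesis .
  qed
  show ?thesis
    unfolding hausdorff_close_def
  proof (intro conjI ballI)
    fix x assume "x \<in> hutchinson R A"
    then obtain j a where j: "j \<in> {1..num_maps R}" "a \<in> A" "x = ifs_map R j a"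
      unfolding hutchinson_def by blast
    moreover obtain b where "b \<in> B" "dist a b \<le> e"
      using close j(2) unfolding hausdorff_close_def by blast
    ultimately show "\<exists>y\<in>hutchinson R B. dist x y \<le> q * e"
      using le unfolding hutchinson_def by blast
  next
    fix y assume "y \<in> hutchinson R B"
    then obtain j b where j: "j \<in> {1..num_maps R}" "b \<in> B" "y = ifs_map R j b"
      unfolding hutchinson_def by blast
    moreover obtain a where "a \<in> A" "dist a b \<le> e"
      using close j(2) unfolding hausdorff_close_def by blast
    ultimately show "\<exists>x\<in>hutchinson R A. dist x y \<le> q * e"
      using le unfolding hutchinson_def by blast
  qed
qed

section \<open>Compositions along a code\<close>

lemma code_iterate_0 [simp]: "code_iterate R \<theta> 0 Z = Z"
  unfolding code_iterate_def by simp

text \<open>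
  The recursion peels off the innermost operator; so the induction hypothesis has to be
  available for all sets, while the code stays fixed.
\<close>
lemma code_iterate_Suc:
  "code_iterate R \<theta> (Suc k) Z = code_iterate R \<theta> k (hutchinson (R (\<theta> (Suc k))) Z)"
  unfolding code_iterate_def by simp

lemma code_iterate_mono: "A \<subseteq> B \<Longrightarrow> code_iterate R \<theta> k A \<subseteq> code_iterate R \<theta> k B"
  by (induction k arbitrary: A B) (simp_all add: code_iterate_Suc hutchinson_mono)

text \<open>
  The ratio \<open>q\<close> is any common bound below 1 for the systems that occur in the code; so the total
  number of systems, and the maximum over them, stay out of the argument.
\<close>
locale contractive_code =
  fixes X :: "'a::metric_space set" and R :: "nat \<Rightarrow> 'a ifs" and \<theta> :: "nat \<Rightarrow> nat" and q :: real
  assumes compact: "compact X" and nonempty: "X \<noteq> {}"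
    and q_nonneg: "0 \<le> q" and q_less_1: "q < 1"
    and contractive: "\<And>j. 1 \<le> j \<Longrightarrow> contractive_ifs X (R (\<theta> j))"
    and contractivity_le: "\<And>j. 1 \<le> j \<Longrightarrow> contractivity (R (\<theta> j)) \<le> q"
begin

lemma X_in_hyperspace: "X \<in> hyperspace X"
  using compact nonempty unfolding hyperspace_def by simp

lemma code_iterate_hyperspace:
  "Z \<in> hyperspace X \<Longrightarrow> code_iterate R \<theta> k Z \<in> hyperspace X"
  by (induction k arbitrary: Z) (simp_all add: code_iterate_Suc hutchinson_hyperspace contractive)

lemma hausdorff_close_code_iterate:
  assumes "A \<in> hyperspace X" "B \<in> hyperspace X" "hausdorff_close e A B"
  shows "hausdorff_close (q ^ k * e) (code_iterate R \<theta> k A) (code_iterate R \<theta> k B)"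
  using assms
proof (induction k arbitrary: A B e)
  case (Suc k)
  let ?F = "hutchinson (R (\<theta> (Suc k)))"
  have "hausdorff_close (q * e) (?F A) (?F B)"
    using Suc.prems
    by (intro hutchinson_close[OF contractive contractivity_le]) (auto simp: hyperspace_def)
  then have "hausdorff_close (q ^ k * (q * e)) (code_iterate R \<theta> k (?F A)) (code_iterate R \<theta> k (?F B))"
    using Suc.prems by (intro Suc.IH hutchinson_hyperspace contractive) auto
  then show ?case by (simp add: code_iterate_Suc mult_ac)
qed simp

lemma code_iterate_add:
  assumes "Z \<in> hyperspace X"
  shows "\<exists>W\<in>hyperspace X. code_iterate R \<theta> (k + m) Z = code_iterate R \<theta> k W"
  using assms
proof (induction m arbitrary: Z)
  case (Suc m)
  then show ?case
    using Suc.IH[of "hutchinson (R (\<theta> (Suc (k + m)))) Z"]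
    by (simp add: code_iterate_Suc hutchinson_hyperspace contractive)
qed auto

section \<open>Existence of the blend\<close>

lemma decseq_code_iterate: "decseq (\<lambda>k. code_iterate R \<theta> k X)"
proof (rule decseq_SucI)
  fix k
  have "hutchinson (R (\<theta> (Suc k))) X \<subseteq> X"
    using hutchinson_hyperspace[OF contractive X_in_hyperspace] unfolding hyperspace_def by simp
  then show "code_iterate R \<theta> (Suc k) X \<subseteq> code_iterate R \<theta> k X"
    unfolding code_iterate_Suc by (rule code_iterate_mono)
qed

definition limit_set :: "'a set" where
  "limit_set = (\<Inter>k. code_iterate R \<theta> k X)"

text \<open>
  By the finite intersection property of compact sets. With \<open>C = UNIV\<close> it gives nonemptiness of
  the limit set, with \<open>C\<close> a closed ball it gives points of the limit set near a given point.
\<close>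
lemma limit_set_meets_closed:
  assumes "closed C" and "\<And>k. code_iterate R \<theta> k X \<inter> C \<noteq> {}"
  shows "limit_set \<inter> C \<noteq> {}"
proof -
  have "(X \<inter> C) \<inter> (\<Inter>k\<in>UNIV. code_iterate R \<theta> k X) \<noteq> {}"
  proof (rule compact_imp_fip_image)
    show "compact (X \<inter> C)" by (rule compact_Int_closed[OF compact assms(1)])
    show "closed (code_iterate R \<theta> k X)" for k
      using code_iterate_hyperspace[OF X_in_hyperspace] compact_imp_closed
      unfolding hyperspace_def by blast
  next
    fix I :: "nat set" assume "finite I"
    then obtain n where "\<forall>k\<in>I. k \<le> n" using finite_nat_set_iff_bounded_le by blast
    then have "code_iterate R \<theta> n X \<subseteq> (\<Inter>k\<in>I. code_iterate R \<theta> k X)"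
      using decseqD[OF decseq_code_iterate] by blast
    moreover have "code_iterate R \<theta> n X \<subseteq> X"
      using code_iterate_hyperspace[OF X_in_hyperspace] unfolding hyperspace_def by blast
    ultimately show "(X \<inter> C) \<inter> (\<Inter>k\<in>I. code_iterate R \<theta> k X) \<noteq> {}"
      using assms(2)[of n] by blast
  qed
  then show ?thesis unfolding limit_set_def by blast
qed

lemma limit_set_hyperspace: "limit_set \<in> hyperspace X"
proof -
  have K: "code_iterate R \<theta> k X \<in> hyperspace X" for k
    by (rule code_iterate_hyperspace[OF X_in_hyperspace])
  have "limit_set \<noteq> {}"
    using limit_set_meets_closed[of UNIV] K unfolding hyperspace_def by auto
  moreover have sub: "limit_set \<subseteq> X"
    unfolding limit_set_def using INT_lower[of 0 UNIV "\<lambda>k. code_iterate R \<theta> k X"] by simp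
  moreover have "compact limit_set"
  proof -
    have "closed limit_set"
      unfolding limit_set_def using K compact_imp_closed unfolding hyperspace_def by blast
    then show ?thesis using compact_Int_closed[OF compact] sub by (metis inf.absorb2)
  qed
  ultimately show ?thesis unfolding hyperspace_def by blast
qed

text \<open>
  Points of the limit set lie in \<open>code_iterate R \<theta> k X\<close>, hence close to \<open>code_iterate R \<theta> k Z\<close>.
  Conversely, the closed ball of radius \<open>q ^ k * diameter X\<close> about a point of
  \<open>code_iterate R \<theta> k Z\<close> meets every later iterate of \<open>X\<close>, since that iterate is the image of
  some subset of \<open>X\<close> under the same outer \<open>k\<close> operators; so it meets the limit set.
\<close>
lemma code_iterate_close_limit_set:
  assumes Z: "Z \<in> hyperspace X"
  shows "hausdorff_close (q ^ k * diameter X) (code_iterate R \<theta> k Z) limit_set"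
proof -
  let ?e = "q ^ k * diameter X"
  have close: "hausdorff_close ?e (code_iterate R \<theta> k Z) (code_iterate R \<theta> k W)"
    if "W \<in> hyperspace X" for W
    using Z that
    by (intro hausdorff_close_code_iterate hausdorff_close_diameter compact_imp_bounded[OF compact])
      (auto simp: hyperspace_def)
  show ?thesis
    unfolding hausdorff_close_def
  proof (intro conjI ballI)
    fix b assume "b \<in> limit_set"
    then have "b \<in> code_iterate R \<theta> k X" unfolding limit_set_def by blast
    then show "\<exists>a\<in>code_iterate R \<theta> k Z. dist a b \<le> ?e"
      using close[OF X_in_hyperspace] unfolding hausdorff_close_def by blast
  next
    fix a assume a: "a \<in> code_iterate R \<theta> k Z"
    have "code_iterate R \<theta> m X \<inter> cball a ?e \<noteq> {}" for m
    proof -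
      obtain W where W: "W \<in> hyperspace X" "code_iterate R \<theta> (k + m) X = code_iterate R \<theta> k W"
        using code_iterate_add[OF X_in_hyperspace] by blast
      then have "code_iterate R \<theta> (k + m) X \<inter> cball a ?e \<noteq> {}"
        using close[OF W(1)] a unfolding hausdorff_close_def W(2) by (metis disjoint_iff mem_cball)
      then show ?thesis
        using decseqD[OF decseq_code_iterate, of m "k + m"] by auto
    qed
    then have "limit_set \<inter> cball a ?e \<noteq> {}" by (intro limit_set_meets_closed) auto
    then show "\<exists>b\<in>limit_set. dist a b \<le> ?e" by auto
  qed
qed

lemma code_iterate_tendsto_limit_set:
  assumes Z: "Z \<in> hyperspace X"
  shows "(\<lambda>k. hausdorff_dist (code_iterate R \<theta> k Z) limit_set) \<longlonglongrightarrow> 0"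
proof (rule tendsto_sandwich)
  have "hausdorff_close (hausdorff_dist (code_iterate R \<theta> k Z) limit_set)
          (code_iterate R \<theta> k Z) limit_set" for k
    using hausdorff_dist_le_iff[OF code_iterate_hyperspace[OF Z] limit_set_hyperspace] by blast
  then have "0 \<le> hausdorff_dist (code_iterate R \<theta> k Z) limit_set" for k
    using limit_set_hyperspace unfolding hausdorff_close_def hyperspace_def
    by (smt (verit) all_not_in_conv mem_Collect_eq zero_le_dist)
  then show "\<forall>\<^sub>F k in sequentially. 0 \<le> hausdorff_dist (code_iterate R \<theta> k Z) limit_set"
    by simp
  have "hausdorff_dist (code_iterate R \<theta> k Z) limit_set \<le> q ^ k * diameter X" for k
    using hausdorff_dist_le_iff[OF code_iterate_hyperspace[OF Z] limit_set_hyperspace]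
      code_iterate_close_limit_set[OF Z] by blast
  then show "\<forall>\<^sub>F k in sequentially.
      hausdorff_dist (code_iterate R \<theta> k Z) limit_set \<le> q ^ k * diameter X"
    by simp
  show "(\<lambda>k. q ^ k * diameter X) \<longlonglongrightarrow> 0"
    using q_nonneg q_less_1 by (intro tendsto_mult_left_zero LIMSEQ_power_zero) simp
qed simp

lemma blend_eq_limit_set: "blend X R \<theta> = limit_set"
  unfolding blend_def
proof (rule the_equality)
  show "limit_set \<in> hyperspace X \<and>
    (\<forall>Z\<in>hyperspace X. (\<lambda>k. hausdorff_dist (code_iterate R \<theta> k Z) limit_set) \<longlonglongrightarrow> 0)"
    using limit_set_hyperspace code_iterate_tendsto_limit_set by blast
next
  fix A
  assume A: "A \<in> hyperspace X \<and>
    (\<forall>Z\<in>hyperspace X. (\<lambda>k. hausdorff_dist (code_iterate R \<theta> k Z) A) \<longlonglongrightarrow> 0)"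
  show "A = limit_set"
    using A X_in_hyperspace
    by (intro hausdorff_limit_unique[of A X limit_set "\<lambda>k. code_iterate R \<theta> k X"]
        limit_set_hyperspace code_iterate_hyperspace code_iterate_tendsto_limit_set) auto
qed

section \<open>Discretized iteration\<close>

text \<open>
  An orbit computed from the inside out with an error of at most \<open>\<epsilon>\<close> at each step: the error made
  at level \<open>j\<close> passes through \<open>j - 1\<close> further operators, which leave at most \<open>q ^ (j - 1) * \<epsilon>\<close> of it.
\<close>
lemma perturbed_iterate_close:
  assumes Y: "\<And>j. j \<in> {1..k + 1} \<Longrightarrow> Y j \<in> hyperspace X"
    and step: "\<And>j. j \<in> {1..k} \<Longrightarrow> hausdorff_close \<epsilon> (hutchinson (R (\<theta> j)) (Y (j + 1))) (Y j)"
  shows "hausdorff_close (\<epsilon> * (\<Sum>j<k. q ^ j)) (code_iterate R \<theta> k (Y (k + 1))) (Y 1)"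
  using assms
proof (induction k)
  case 0
  show ?case by (auto simp: hausdorff_close_def)
next
  case (Suc k)
  let ?F = "hutchinson (R (\<theta> (Suc k)))"
  have "hausdorff_close (q ^ k * \<epsilon>) (code_iterate R \<theta> k (?F (Y (k + 2)))) (code_iterate R \<theta> k (Y (k + 1)))"
    using Suc.prems(1)[of "k + 1"] Suc.prems(1)[of "k + 2"] Suc.prems(2)[of "k + 1"]
    by (intro hausdorff_close_code_iterate hutchinson_hyperspace contractive) auto
  moreover have "hausdorff_close (\<epsilon> * (\<Sum>j<k. q ^ j)) (code_iterate R \<theta> k (Y (k + 1))) (Y 1)"
    using Suc.prems by (intro Suc.IH) auto
  ultimately have "hausdorff_close (q ^ k * \<epsilon> + \<epsilon> * (\<Sum>j<k. q ^ j))
      (code_iterate R \<theta> k (?F (Y (k + 2)))) (Y 1)"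
    by (rule hausdorff_close_trans)
  then show ?case by (simp add: code_iterate_Suc algebra_simps)
qed

lemma discretized_iterate_close:
  assumes \<epsilon>: "0 \<le> \<epsilon>" and Z: "Z \<in> hyperspace X"
    and disc: "discretization \<epsilon> X Xh r" and fin: "finite Xh"
    and start: "Y (k + 1) = r ` Z"
    and step: "\<And>j. j \<in> {1..k} \<Longrightarrow> Y j = r ` hutchinson (R (\<theta> j)) (r ` Y (j + 1))"
  shows "Y 1 \<in> hyperspace X"
    and "hausdorff_close (\<epsilon> / (1 - q)) (code_iterate R \<theta> k Z) (Y 1)"
proof -
  have r: "r ` B \<in> hyperspace X" "r ` B \<subseteq> Xh" "hausdorff_close \<epsilon> B (r ` B)"
    if B: "B \<in> hyperspace X" for B
  proof -
    have "B \<subseteq> X" using B unfolding hyperspace_def by simp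
    then show *: "r ` B \<subseteq> Xh" and "hausdorff_close \<epsilon> B (r ` B)"
      using disc unfolding discretization_def eps_projection_def
      by (auto intro!: hausdorff_close_image)
    have "finite (r ` B)" using * fin finite_subset by blast
    then show "r ` B \<in> hyperspace X"
      using * B disc unfolding discretization_def eps_net_def hyperspace_def
      by (auto intro: finite_imp_compact)
  qed
  \<comment> \<open>All \<open>Y j\<close> lie on the net already; so the inner projection in \<open>step\<close> causes no error.\<close>
  have fixed: "r ` B = B" if "B \<subseteq> Xh" for B
    using that disc unfolding discretization_def eps_projection_def by force
  have Y: "Y j \<in> hyperspace X \<and> Y j \<subseteq> Xh" if "j \<in> {1..k + 1}" for j
  proof -
    have "1 \<le> j" "j \<le> k + 1" using that by auto
    from this(2,1) show ?thesis
    proof (induction j rule: inc_induct)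
      case base
      show ?case using r[OF Z] start by simp
    next
      case (step j)
      then have "hutchinson (R (\<theta> j)) (r ` Y (j + 1)) \<in> hyperspace X"
        by (intro hutchinson_hyperspace contractive r) auto
      then show ?case using r assms(6)[of j] step by auto
    qed
  qed
  show "Y 1 \<in> hyperspace X" using Y by simp
  have "hausdorff_close \<epsilon> (hutchinson (R (\<theta> j)) (Y (j + 1))) (Y j)" if j: "j \<in> {1..k}" for j
  proof -
    have "Y (j + 1) \<in> hyperspace X" "Y (j + 1) \<subseteq> Xh" using Y j by auto
    then show ?thesis
      using step[OF j] fixed r(3)[OF hutchinson_hyperspace[OF contractive]] j by auto
  qed
  then have "hausdorff_close (\<epsilon> * (\<Sum>j<k. q ^ j)) (code_iterate R \<theta> k (r ` Z)) (Y 1)"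
    using perturbed_iterate_close[of k Y \<epsilon>] Y start by simp
  with hausdorff_close_code_iterate[OF Z r(1)[OF Z] r(3)[OF Z], of k]
  have "hausdorff_close (q ^ k * \<epsilon> + \<epsilon> * (\<Sum>j<k. q ^ j)) (code_iterate R \<theta> k Z) (Y 1)"
    by (rule hausdorff_close_trans)
  moreover have "q ^ k * \<epsilon> + \<epsilon> * (\<Sum>j<k. q ^ j) \<le> \<epsilon> / (1 - q)"
  proof -
    have "q ^ k * \<epsilon> + \<epsilon> * (\<Sum>j<k. q ^ j) = \<epsilon> * (\<Sum>j<Suc k. q ^ j)"
      by (simp add: algebra_simps)
    also have "\<dots> = \<epsilon> * (1 - q ^ Suc k) / (1 - q)"
      using q_less_1 by (subst sum_gp_strict) auto
    also have "\<dots> \<le> \<epsilon> / (1 - q)"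
      using \<epsilon> q_nonneg q_less_1
      by (intro divide_right_mono) (simp_all add: mult_left_le)
    finally show ?thesis .
  qed
  ultimately show "hausdorff_close (\<epsilon> / (1 - q)) (code_iterate R \<theta> k Z) (Y 1)"
    by (rule hausdorff_close_mono)
qed

end

section \<open>Approximation of the blend\<close>

theorem theorem4p3:
  fixes X :: "'a::metric_space set"
    and N k :: nat
    and R :: "nat \<Rightarrow> 'a ifs"
    and \<theta> :: "nat \<Rightarrow> nat"
    and Z Xh :: "'a set"
    and r :: "'a \<Rightarrow> 'a"
    and \<epsilon> :: real
    and Y :: "nat \<Rightarrow> 'a set"
  assumes "compact X"
    and "\<And>i. i \<in> {1..N} \<Longrightarrow> contractive_ifs X (R i)"
    and "Z \<in> hyperspace X"
    and "\<And>j. j \<ge> 1 \<Longrightarrow> \<theta> j \<in> {1..N}"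
    and "\<epsilon> > 0"
    and "discretization \<epsilon> X Xh r"
    and "finite Xh"
    and "k \<ge> 1"
    and "Y (k + 1) = r ` Z"
    and "\<And>j. j \<in> {1..k} \<Longrightarrow> Y j = r ` hutchinson (R (\<theta> j)) (r ` Y (j + 1))"
  shows "hausdorff_dist (code_iterate R \<theta> k Z) (Y 1)
           \<le> \<epsilon> / (1 - contractivity (blending N R)) \<and>
         hausdorff_dist (blend X R \<theta>) (Y 1)
           \<le> contractivity (blending N R) ^ k * diameter X
             + \<epsilon> / (1 - contractivity (blending N R))"
proof -
  let ?q = "contractivity (blending N R)"
  have N: "1 \<le> N" using assms(4)[of 1] by simp
  have q: "?q = Max ((\<lambda>i. contractivity (R i)) ` {1..N})"
    unfolding contractivity_def[of "blending N R"] by (simp add: blending_def)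
  have "?q \<in> (\<lambda>i. contractivity (R i)) ` {1..N}"
    unfolding q using N by (intro Max_in) auto
  then have q01: "0 \<le> ?q" "?q < 1" using contractivity_bounds[OF assms(2)] by auto
  interpret contractive_code X R \<theta> ?q
  proof
    show "X \<noteq> {}" using assms(3) unfolding hyperspace_def by auto
    show "contractivity (R (\<theta> j)) \<le> ?q" if "1 \<le> j" for j
      unfolding q using assms(4)[OF that] by (intro Max_ge) auto
  qed (use assms q01 in auto)
  note Y1 = discretized_iterate_close[OF less_imp_le[OF assms(5)] assms(3,6,7,9,10)]
  have iterate: "hausdorff_dist (code_iterate R \<theta> k Z) (Y 1) \<le> \<epsilon> / (1 - ?q)"
    using Y1 hausdorff_dist_le_iff[OF code_iterate_hyperspace[OF assms(3)] Y1(1)] by blast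
  have "hausdorff_close (?q ^ k * diameter X + \<epsilon> / (1 - ?q)) limit_set (Y 1)"
    using hausdorff_close_trans[OF hausdorff_close_sym[OF code_iterate_close_limit_set] Y1(2)]
      assms(3) by blast
  then have "hausdorff_dist (blend X R \<theta>) (Y 1) \<le> ?q ^ k * diameter X + \<epsilon> / (1 - ?q)"
    unfolding blend_eq_limit_set
    using hausdorff_dist_le_iff[OF limit_set_hyperspace Y1(1)] by blast
  with iterate show ?thesis by blast
qed

end
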